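(* Let $E$ be a strongly truncated Riesz space. Then \[ \bigcap_{u\in\eta E}\ker u=E_{\ast}, \] that is, for $f\in E$, one has $u(f)=0$ for all $u\in\eta E$ if and only if $f\in E_{\ast}$.
   Context: A Riesz space is a real vector lattice, with positive cone $E^{+}$. A truncation on a Riesz space $E$ is a unary operation $\ast:E^{+}\to E^{+}$, $f\mapsto f^{\ast}$, such that $f^{\ast}\wedge g=f\wedge g^{\ast}$ for all $f,g\in E^{+}$; a Riesz space with a truncation is called a truncated Riesz space. Put $P_{\ast}(E)=\{f\in E^{+}:f^{\ast}=f\}$. The truncation is strong if for each $f\in E^{+}$ there is $\varepsilon\in(0,\infty)$ with $\varepsilon f\in P_{\ast}(E)$; a Riesz space with a strong truncation is called a strongly truncated Riesz space. An element $f\in E$ is $^{\ast}$-infinitely small if $\varepsilon|f|\in P_{\ast}(E)$ for all $\varepsilon\in(0,\infty)$, and $E_{\ast}$ denotes the set of all $^{\ast}$-infinitely small elements of $E$. The spectrum $\eta E$ is the set of all nonzero Riesz homomorphisms (linear lattice homomorphisms) $u:E\to\mathbb{R}$ such that $u(f^{\ast})=\min\{1,u(f)\}$ for all $f\in E^{+}$; $\ker u=\{f\in E:u(f)=0\}$. The intersection is taken among subsets of $E$. *)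

theory Defs
  imports Complex_Main "HOL-Library.Lattice_Algebras"
begin

text \<open>Real vector lattices; the inherited axiom \<open>abs_lattice\<close> fixes
  \<open>\<bar>f\<bar> = sup f (- f)\<close>.\<close>

class riesz_space = ordered_real_vector + lattice_ab_group_add_abs

instance real :: riesz_space
  by standard (simp add: abs_if sup_real_def)

definition riesz_hom :: "('a::riesz_space \<Rightarrow> 'b::riesz_space) \<Rightarrow> bool"
  where "riesz_hom u \<longleftrightarrow> linear u \<and>
    (\<forall>f g. u (sup f g) = sup (u f) (u g)) \<and> (\<forall>f g. u (inf f g) = inf (u f) (u g))"

text \<open>A truncation is a unary operation on the positive cone only. It is represented by a total
  function \<open>t\<close>, about whose values outside the positive cone nothing is assumed and which are
  never used.\<close>

definition truncation :: "('a::riesz_space \<Rightarrow> 'a) \<Rightarrow> bool"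
  where "truncation t \<longleftrightarrow>
    (\<forall>f\<ge>0. t f \<ge> 0) \<and> (\<forall>f\<ge>0. \<forall>g\<ge>0. inf (t f) g = inf f (t g))"

definition truncation_fixed :: "('a::riesz_space \<Rightarrow> 'a) \<Rightarrow> 'a set"
  where "truncation_fixed t = {f. f \<ge> 0 \<and> t f = f}"

definition strong_truncation :: "('a::riesz_space \<Rightarrow> 'a) \<Rightarrow> bool"
  where "strong_truncation t \<longleftrightarrow>
    truncation t \<and> (\<forall>f\<ge>0. \<exists>\<epsilon>>0. \<epsilon> *\<^sub>R f \<in> truncation_fixed t)"

definition infinitely_small :: "('a::riesz_space \<Rightarrow> 'a) \<Rightarrow> 'a set"
  where "infinitely_small t = {f. \<forall>\<epsilon>>0. \<epsilon> *\<^sub>R \<bar>f\<bar> \<in> truncation_fixed t}"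

definition spectrum :: "('a::riesz_space \<Rightarrow> 'a) \<Rightarrow> ('a \<Rightarrow> real) set"
  where "spectrum t =
    {u. riesz_hom u \<and> u \<noteq> (\<lambda>f. 0) \<and> (\<forall>f\<ge>0. u (t f) = min 1 (u f))}"

definition hom_kernel :: "('a::riesz_space \<Rightarrow> real) \<Rightarrow> 'a set"
  where "hom_kernel u = {f. u f = 0}"

end

theory Submission
  imports Defs
begin

text \<open>
  The elements fixed by the truncation \<open>t\<close> play the part of the elements of the positive cone below a
  unit that need not exist in the space; \<open>t f\<close> stands for the infimum of \<open>f\<close> and that unit. The gauge
  \<open>truncation_gauge t f\<close>, the infimum of all \<open>r > 0\<close> such that \<open>f\<close> lies below \<open>r\<close> times a fixed
  element, is the analogue of the supremum of the positive part of a function. Fixed elements form a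
  lower set of the positive cone and are closed under binary suprema, so the gauge is sublinear and
  turns binary suprema into maxima.
  If \<open>\<epsilon> *\<^sub>R \<bar>f\<bar>\<close> is not fixed for some \<open>\<epsilon> > 0\<close>, its gauge is at least \<open>1\<close>.

  The existence of homomorphisms comes from a lattice version of the Hahn-Banach theorem
  (\<open>riesz_hom_attaining\<close>): for a sublinear functional \<open>q\<close> that turns suprema into maxima
  and a vector \<open>g\<close> there is a Riesz homomorphism below \<open>q\<close> that agrees with \<open>q\<close> at \<open>g\<close>. It is a minimal
  functional of that kind, obtained from Zorn's lemma. In the model case, where \<open>q\<close> is the maximum over a compact set of points, passing to a
  smaller functional means shrinking the set, and a minimal one is the evaluation at a point. The
  shrinking step (\<open>peak_functional\<close>) restricts to the points where a given vector is largest.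

  Apply this to the gauge and to a vector \<open>g = \<epsilon> *\<^sub>R \<bar>f\<bar>\<close> that is not fixed. The resulting \<open>u\<close>
  satisfies \<open>u (t k) \<le> 1\<close> for every \<open>k\<close> in the positive cone. The gauge of \<open>g - t g\<close> is at most that
  of \<open>g\<close> minus \<open>1\<close>, which gives \<open>u (t g) = 1\<close>. Evaluated by \<open>u\<close>, the identity
  \<open>inf (t k) g = inf k (t g)\<close> then yields \<open>u (t k) = min 1 (u k)\<close>, so \<open>u\<close> is in the spectrum, while
  \<open>u f \<noteq> 0\<close>. The other inclusion is direct: a point \<open>u\<close> of the spectrum is at most \<open>1\<close> on fixed
  elements, so it bounds every positive multiple of \<open>u \<bar>f\<bar>\<close> by \<open>1\<close> when \<open>f\<close> is infinitely small.
\<close>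

section \<open>Functionals that behave like a supremum over a set of points\<close>

definition sup_sublinear :: "('a::riesz_space \<Rightarrow> real) \<Rightarrow> bool"
  where "sup_sublinear p \<longleftrightarrow>
    (\<forall>f g. p (f + g) \<le> p f + p g) \<and> (\<forall>c\<ge>0. \<forall>f. p (c *\<^sub>R f) = c * p f) \<and>
    (\<forall>f g. p (sup f g) = max (p f) (p g))"

lemma sup_sublinearD:
  assumes "sup_sublinear p"
  shows "p (f + g) \<le> p f + p g" and "c \<ge> 0 \<Longrightarrow> p (c *\<^sub>R f) = c * p f"
    and "p (sup f g) = max (p f) (p g)"
  using assms unfolding sup_sublinear_def by auto

text \<open>An inequality is enough for positive homogeneity, since scaling by a positive factor can be undone.\<close>

lemma sup_sublinearI:
  fixes p :: "'a::riesz_space \<Rightarrow> real"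
  assumes add: "\<And>f g. p (f + g) \<le> p f + p g"
    and zero: "p 0 = 0"
    and scale: "\<And>c f. c > 0 \<Longrightarrow> p (c *\<^sub>R f) \<le> c * p f"
    and sup: "\<And>f g. p (sup f g) = max (p f) (p g)"
  shows "sup_sublinear p"
proof -
  have "p (c *\<^sub>R f) = c * p f" if "c \<ge> 0" for c f
  proof (cases "c = 0")
    case False
    with that have c: "c > 0" by simp
    have "p f \<le> inverse c * p (c *\<^sub>R f)"
      using scale[of "inverse c" "c *\<^sub>R f"] c by simp
    then have "c * p f \<le> p (c *\<^sub>R f)"
      using c by (simp add: field_simps)
    with scale[OF c, of f] show ?thesis by simp
  qed (simp add: zero)
  with add sup show ?thesis unfolding sup_sublinear_def by blast
qed

lemma sup_sublinear_zero: "sup_sublinear p \<Longrightarrow> p 0 = 0"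
  using sup_sublinearD(2)[of p 0 0] by simp

lemma sup_sublinear_minus_lower: "sup_sublinear p \<Longrightarrow> - p (- f) \<le> p f"
  using sup_sublinearD(1)[of p f "- f"] sup_sublinear_zero[of p] by simp

lemma INF_max_directed:
  fixes a b :: "'i \<Rightarrow> real"
  assumes ne: "I \<noteq> {}" and bdd: "bdd_below (a ` I)" "bdd_below (b ` I)"
    and dir: "\<And>i j. i \<in> I \<Longrightarrow> j \<in> I \<Longrightarrow> \<exists>k\<in>I. a k \<le> a i \<and> b k \<le> b j"
  shows "(INF i\<in>I. max (a i) (b i)) = max (INF i\<in>I. a i) (INF i\<in>I. b i)"
proof (rule antisym)
  show "max (INF i\<in>I. a i) (INF i\<in>I. b i) \<le> (INF i\<in>I. max (a i) (b i))"
  proof (rule cINF_greatest[OF ne])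
    fix i assume "i \<in> I"
    then show "max (INF i\<in>I. a i) (INF i\<in>I. b i) \<le> max (a i) (b i)"
      using cINF_lower[OF bdd(1)] cINF_lower[OF bdd(2)] by (intro max.mono) auto
  qed
  have bdd_max: "bdd_below ((\<lambda>i. max (a i) (b i)) ` I)"
  proof -
    obtain m where "\<And>i. i \<in> I \<Longrightarrow> m \<le> a i" using bdd(1) by (auto simp: bdd_below_def)
    then show ?thesis by (intro bdd_belowI2[of _ m]) (auto intro: max.coboundedI1)
  qed
  show "(INF i\<in>I. max (a i) (b i)) \<le> max (INF i\<in>I. a i) (INF i\<in>I. b i)"
  proof (rule field_le_epsilon)
    fix e :: real assume e: "e > 0"
    obtain i where i: "i \<in> I" "a i < (INF i\<in>I. a i) + e"
      using cINF_less_iff[OF ne bdd(1)] e by (metis less_add_same_cancel1)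
    obtain j where j: "j \<in> I" "b j < (INF i\<in>I. b i) + e"
      using cINF_less_iff[OF ne bdd(2)] e by (metis less_add_same_cancel1)
    obtain k where k: "k \<in> I" "a k \<le> a i" "b k \<le> b j" using dir[OF i(1) j(1)] by blast
    have "(INF i\<in>I. max (a i) (b i)) \<le> max (a k) (b k)" by (rule cINF_lower[OF bdd_max k(1)])
    also have "\<dots> \<le> max (INF i\<in>I. a i) (INF i\<in>I. b i) + e" using i j k by linarith
    finally show "(INF i\<in>I. max (a i) (b i)) \<le> max (INF i\<in>I. a i) (INF i\<in>I. b i) + e" .
  qed
qed

text \<open>
  In the model case this is the intersection of a chain of nonempty compact sets. Under a common upper
  bound the values at a vector cannot run off to minus infinity, because of \<open>sup_sublinear_minus_lower\<close>. Any
  two functionals of the chain can be replaced by the smaller one, which makes the infimum commute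
  with sums and maxima.
\<close>

lemma sup_sublinear_chain_INF:
  fixes C :: "('a::riesz_space \<Rightarrow> real) set"
  assumes ne: "C \<noteq> {}" and sub: "\<And>s. s \<in> C \<Longrightarrow> sup_sublinear s" and le: "\<And>s. s \<in> C \<Longrightarrow> s \<le> q"
    and chain: "\<And>s s'. s \<in> C \<Longrightarrow> s' \<in> C \<Longrightarrow> s \<le> s' \<or> s' \<le> s"
  shows "sup_sublinear (\<lambda>f. INF s\<in>C. s f)" and "\<And>s f. s \<in> C \<Longrightarrow> (INF s\<in>C. s f) \<le> s f"
proof -
  have bdd: "bdd_below ((\<lambda>s. s f) ` C)" for f
  proof (rule bdd_belowI2)
    fix s assume s: "s \<in> C"
    have "- q (- f) \<le> - s (- f)" using le[OF s] by (simp add: le_fun_def)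
    also have "\<dots> \<le> s f" by (rule sup_sublinear_minus_lower[OF sub[OF s]])
    finally show "- q (- f) \<le> s f" .
  qed
  show low: "\<And>s f. s \<in> C \<Longrightarrow> (INF s\<in>C. s f) \<le> s f" by (rule cINF_lower[OF bdd])
  have dir: "\<exists>k\<in>C. k f \<le> s f \<and> k g \<le> s' g" if "s \<in> C" "s' \<in> C" for s s' f g
    using chain[OF that] that by (auto simp: le_fun_def)
  show "sup_sublinear (\<lambda>f. INF s\<in>C. s f)"
  proof (rule sup_sublinearI)
    fix f g :: 'a
    have "(INF s\<in>C. s (f + g)) - (INF s\<in>C. s g) \<le> s f" if s: "s \<in> C" for s
    proof -
      have "(INF s\<in>C. s (f + g)) - s f \<le> s' g" if s': "s' \<in> C" for s'
      proof -
        obtain k where k: "k \<in> C" "k f \<le> s f" "k g \<le> s' g" using dir[OF s s'] by blast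
        then show ?thesis
          using low[OF k(1), of "f + g"] sup_sublinearD(1)[OF sub[OF k(1)], of f g] by linarith
      qed
      then have "(INF s\<in>C. s (f + g)) - s f \<le> (INF s\<in>C. s g)" by (rule cINF_greatest[OF ne])
      then show ?thesis by linarith
    qed
    then have "(INF s\<in>C. s (f + g)) - (INF s\<in>C. s g) \<le> (INF s\<in>C. s f)"
      by (rule cINF_greatest[OF ne])
    then show "(INF s\<in>C. s (f + g)) \<le> (INF s\<in>C. s f) + (INF s\<in>C. s g)" by linarith
    have "(INF s\<in>C. s (sup f g)) = (INF s\<in>C. max (s f) (s g))"
      by (intro INF_cong) (auto simp: sup_sublinearD(3)[OF sub])
    also have "\<dots> = max (INF s\<in>C. s f) (INF s\<in>C. s g)"
      by (rule INF_max_directed[OF ne bdd bdd dir])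
    finally show "(INF s\<in>C. s (sup f g)) = max (INF s\<in>C. s f) (INF s\<in>C. s g)" .
  next
    have "(INF s\<in>C. s (0::'a)) = (INF s\<in>C. (0::real))"
      by (intro INF_cong) (auto simp: sup_sublinear_zero[OF sub])
    then show "(INF s\<in>C. s (0::'a)) = 0" using ne by simp
  next
    fix c :: real and f :: 'a assume c: "c > 0"
    have "(INF s\<in>C. s (c *\<^sub>R f)) / c \<le> s f" if "s \<in> C" for s
      using low[OF that, of "c *\<^sub>R f"] sup_sublinearD(2)[OF sub[OF that], of c f] c
      by (simp add: field_simps)
    then have "(INF s\<in>C. s (c *\<^sub>R f)) / c \<le> (INF s\<in>C. s f)" by (rule cINF_greatest[OF ne])
    then show "(INF s\<in>C. s (c *\<^sub>R f)) \<le> c * (INF s\<in>C. s f)" using c by (simp add: field_simps)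
  qed
qed

text \<open>
  When \<open>q\<close> is the maximum over a compact set, this is the maximum over the subset on which \<open>h\<close> attains
  its maximum: adding a large multiple of \<open>h\<close> forces the maximum to be attained near that subset.
\<close>

definition peak_functional :: "('a::riesz_space \<Rightarrow> real) \<Rightarrow> 'a \<Rightarrow> 'a \<Rightarrow> real"
  where "peak_functional q h f = (INF s\<in>{0..}. q (f + s *\<^sub>R h) - s * q h)"

text \<open>
  The expression under the infimum is antitone in \<open>s\<close>, so the infimum commutes with maxima. Together
  with the fact that translation by \<open>s *\<^sub>R h\<close> commutes with suprema, this turns suprema into maxima.
\<close>

lemma peak_functional:
  fixes q :: "'a::riesz_space \<Rightarrow> real"
  assumes q: "sup_sublinear q"
  shows "sup_sublinear (peak_functional q h)"
    and "s \<ge> 0 \<Longrightarrow> peak_functional q h f \<le> q (f + s *\<^sub>R h) - s * q h"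
proof -
  define v where "v f s = q (f + s *\<^sub>R h) - s * q h" for f s
  have pf: "peak_functional q h f = (INF s\<in>{0..}. v f s)" for f
    by (simp add: peak_functional_def v_def)
  have lb: "- q (- f) \<le> v f s" if "s \<ge> 0" for f s
    using sup_sublinearD(1)[OF q, of "f + s *\<^sub>R h" "- f"] sup_sublinearD(2)[OF q that, of h]
    by (simp add: v_def)
  have bdd: "bdd_below (v f ` {0..})" for f
    by (rule bdd_belowI2[of _ "- q (- f)"]) (simp add: lb)
  have low: "peak_functional q h f \<le> v f s" if "s \<ge> 0" for f s
    unfolding pf by (rule cINF_lower[OF bdd]) (simp add: that)
  have great: "m \<le> peak_functional q h f" if "\<And>s. s \<ge> 0 \<Longrightarrow> m \<le> v f s" for m f
    unfolding pf by (rule cINF_greatest) (auto simp: that)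
  have anti: "v f s' \<le> v f s" if "0 \<le> s" "s \<le> s'" for f s s'
  proof -
    have "f + s' *\<^sub>R h = (f + s *\<^sub>R h) + (s' - s) *\<^sub>R h" by (simp add: algebra_simps)
    then have "q (f + s' *\<^sub>R h) \<le> q (f + s *\<^sub>R h) + (s' - s) * q h"
      using sup_sublinearD(1)[OF q, of "f + s *\<^sub>R h" "(s' - s) *\<^sub>R h"]
        sup_sublinearD(2)[OF q, of "s' - s" h] that by (metis diff_ge_0_iff_ge)
    then show ?thesis by (simp add: v_def algebra_simps)
  qed
  show "s \<ge> 0 \<Longrightarrow> peak_functional q h f \<le> q (f + s *\<^sub>R h) - s * q h"
    using low by (simp add: v_def)
  show "sup_sublinear (peak_functional q h)"
  proof (rule sup_sublinearI)
    fix f g :: 'a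
    have "peak_functional q h (f + g) - peak_functional q h g \<le> v f s" if s: "s \<ge> 0" for s
    proof -
      have "peak_functional q h (f + g) - v f s \<le> v g s'" if s': "s' \<ge> 0" for s'
      proof -
        have "f + g + (s + s') *\<^sub>R h = (f + s *\<^sub>R h) + (g + s' *\<^sub>R h)"
          by (simp add: algebra_simps)
        then have "v (f + g) (s + s') \<le> v f s + v g s'"
          using sup_sublinearD(1)[OF q, of "f + s *\<^sub>R h" "g + s' *\<^sub>R h"]
          by (simp add: v_def algebra_simps)
        then show ?thesis using low[of "s + s'" "f + g"] s s' by linarith
      qed
      from great[OF this] show ?thesis by linarith
    qed
    from great[OF this]
    show "peak_functional q h (f + g) \<le> peak_functional q h f + peak_functional q h g" by linarith
    have "v (sup f g) s = max (v f s) (v g s)" for s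
    proof -
      have "sup f g + s *\<^sub>R h = sup (f + s *\<^sub>R h) (g + s *\<^sub>R h)" by (rule add_sup_distrib_right)
      then show ?thesis by (simp add: v_def sup_sublinearD(3)[OF q] max_def)
    qed
    then have "peak_functional q h (sup f g) = (INF s\<in>{0..}. max (v f s) (v g s))" by (simp add: pf)
    also have "\<dots> = max (INF s\<in>{0..}. v f s) (INF s\<in>{0..}. v g s)"
    proof (rule INF_max_directed[OF _ bdd bdd])
      fix i j :: real assume "i \<in> {0..}" "j \<in> {0..}"
      then show "\<exists>k\<in>{0..}. v f k \<le> v f i \<and> v g k \<le> v g j"
        by (intro bexI[of _ "max i j"]) (auto intro!: anti)
    qed simp
    finally show "peak_functional q h (sup f g) = max (peak_functional q h f) (peak_functional q h g)"
      by (simp add: pf)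
  next
    have "v 0 s = 0" if "s \<ge> 0" for s using sup_sublinearD(2)[OF q that, of h] by (simp add: v_def)
    then have "(INF s\<in>{0..}. v 0 s) = (INF s\<in>{0::real..}. (0::real))" by (intro INF_cong) auto
    then show "peak_functional q h 0 = 0" by (simp add: pf)
  next
    fix c :: real and f :: 'a assume c: "c > 0"
    have "peak_functional q h (c *\<^sub>R f) / c \<le> v f s" if s: "s \<ge> 0" for s
    proof -
      have "v (c *\<^sub>R f) (c * s) = c * v f s"
        using sup_sublinearD(2)[OF q, of c "f + s *\<^sub>R h"] c by (simp add: v_def algebra_simps)
      then show ?thesis using low[of "c * s" "c *\<^sub>R f"] c s by (simp add: field_simps)
    qed
    from great[OF this] show "peak_functional q h (c *\<^sub>R f) \<le> c * peak_functional q h f"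
      using c by (simp add: field_simps)
  qed
qed

section \<open>Minimal functionals are Riesz homomorphisms\<close>

lemma sup_sublinear_additive_imp_riesz_hom:
  fixes u :: "'a::riesz_space \<Rightarrow> real"
  assumes u: "sup_sublinear u" and add: "\<And>f g. u (f + g) = u f + u g"
  shows "riesz_hom u"
proof -
  have minus: "u (- f) = - u f" for f
    using add[of f "- f"] sup_sublinear_zero[OF u] by simp
  have scale: "u (c *\<^sub>R f) = c * u f" for c f
  proof (cases "c \<ge> 0")
    case False
    then show ?thesis
      using sup_sublinearD(2)[OF u, of "- c" f] minus[of "c *\<^sub>R f"] by simp
  qed (rule sup_sublinearD(2)[OF u])
  have sup: "u (sup f g) = sup (u f) (u g)" for f g
    by (simp add: sup_sublinearD(3)[OF u] sup_max)
  have "u (inf f g) = inf (u f) (u g)" for f g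
    unfolding inf_eq_neg_sup[of f g] inf_eq_neg_sup[of "u f" "u g"] minus sup ..
  then show ?thesis unfolding riesz_hom_def using add scale sup by (auto intro: linearI)
qed

text \<open>
  A minimal \<open>u\<close> equals each of its peak functionals, so \<open>u f \<le> u (f + h) - u h\<close>, the inequality that
  subadditivity lacks.
\<close>

lemma minimal_sup_sublinear_riesz_hom:
  fixes q :: "'a::riesz_space \<Rightarrow> real"
  assumes q: "sup_sublinear q"
  shows "\<exists>u. riesz_hom u \<and> u \<le> q"
proof -
  define A where "A = {s. sup_sublinear s \<and> s \<le> q}"
  have "\<exists>m\<in>A. \<forall>a\<in>A. m \<ge> a \<longrightarrow> a = m"
  proof (rule predicate_Zorn)
    show "partial_order_on A (relation_of (\<lambda>a b. a \<ge> b) A)"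
      by (rule partial_order_on_relation_ofI) auto
  next
    fix C assume C: "C \<in> Chains (relation_of (\<lambda>a b. a \<ge> b) A)"
    show "\<exists>l\<in>A. \<forall>a\<in>C. a \<ge> l"
    proof (cases "C = {}")
      case True
      then show ?thesis using q by (auto simp: A_def)
    next
      case False
      have CA: "C \<subseteq> A" and tot: "\<And>s s'. s \<in> C \<Longrightarrow> s' \<in> C \<Longrightarrow> s \<le> s' \<or> s' \<le> s"
        using C by (auto simp: Chains_def relation_of_def)
      have sub: "\<And>s. s \<in> C \<Longrightarrow> sup_sublinear s" and le: "\<And>s. s \<in> C \<Longrightarrow> s \<le> q"
        using CA by (auto simp: A_def)
      note inf = sup_sublinear_chain_INF[OF False sub le tot]
      obtain s where s: "s \<in> C" using False by blast
      have lower: "\<And>s. s \<in> C \<Longrightarrow> (\<lambda>f. INF s\<in>C. s f) \<le> s" by (rule le_funI, rule inf(2))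
      have "(\<lambda>f. INF s\<in>C. s f) \<in> A"
        using inf(1) order_trans[OF lower[OF s] le[OF s]] by (simp add: A_def)
      then show ?thesis using lower by blast
    qed
  qed
  then obtain u where uA: "u \<in> A" and min: "\<And>a. a \<in> A \<Longrightarrow> a \<le> u \<Longrightarrow> a = u" by blast
  have u: "sup_sublinear u" and uq: "u \<le> q" using uA by (auto simp: A_def)
  have "u (f + h) = u f + u h" for f h
  proof -
    have le: "peak_functional u h \<le> u" using peak_functional(2)[OF u, of 0 h] by (simp add: le_fun_def)
    then have "peak_functional u h \<in> A" using peak_functional(1)[OF u] uq by (auto simp: A_def)
    then have "peak_functional u h = u" using min le by blast
    then have "u f \<le> u (f + h) - u h" using peak_functional(2)[OF u, of 1 h f] by simp
    then show ?thesis using sup_sublinearD(1)[OF u, of f h] by simp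
  qed
  then have "riesz_hom u" by (rule sup_sublinear_additive_imp_riesz_hom[OF u])
  with uq show ?thesis by blast
qed

text \<open>
  The peak functional of \<open>q\<close> at \<open>g\<close> is at most \<open>- q g\<close> at \<open>- g\<close>, so a linear functional below it takes a
  value of at least \<open>q g\<close> at \<open>g\<close>.
\<close>

lemma riesz_hom_attaining:
  fixes q :: "'a::riesz_space \<Rightarrow> real"
  assumes q: "sup_sublinear q"
  shows "\<exists>u. riesz_hom u \<and> u \<le> q \<and> u g = q g"
proof -
  obtain u where u: "riesz_hom u" and upeak: "u \<le> peak_functional q g"
    using minimal_sup_sublinear_riesz_hom[OF peak_functional(1)[OF q, of g]] by blast
  have le: "u f \<le> peak_functional q g f" for f using upeak by (simp add: le_fun_def)
  have uq: "u f \<le> q f" for f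
    using le[of f] peak_functional(2)[OF q, of 0 g f] by simp
  have "u (- g) \<le> - q g"
    using le[of "- g"] peak_functional(2)[OF q, of 1 g "- g"] sup_sublinear_zero[OF q] by simp
  moreover have "u (- g) = - u g" using u by (simp add: riesz_hom_def linear_neg)
  ultimately have "u g = q g" using uq[of g] by simp
  moreover have "u \<le> q" by (rule le_funI) (rule uq)
  ultimately show ?thesis using u by blast
qed

section \<open>Fixed elements of a truncation\<close>

lemma truncationD:
  assumes "truncation t" and "f \<ge> 0"
  shows "t f \<ge> 0" and "g \<ge> 0 \<Longrightarrow> inf (t f) g = inf f (t g)"
  using assms unfolding truncation_def by auto

text \<open>Both facts come from the defining identity with \<open>t f\<close> as second argument.\<close>

lemma truncation_le_and_fixed:
  assumes t: "truncation t" and f: "f \<ge> 0"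
  shows "t f \<le> f" and "t f \<in> truncation_fixed t"
proof -
  have le: "t f \<le> f" if "f \<ge> 0" for f
    using truncationD(2)[OF t that truncationD(1)[OF t that]] by (metis inf.cobounded1 inf.idem)
  show "t f \<le> f" by (rule le[OF f])
  have "t f \<le> t (t f)"
    using truncationD(2)[OF t f truncationD(1)[OF t f]] by (metis inf.cobounded2 inf.idem)
  then show "t f \<in> truncation_fixed t"
    using le[OF truncationD(1)[OF t f]] truncationD(1)[OF t f] by (simp add: truncation_fixed_def)
qed

lemma truncation_fixed_downward:
  assumes t: "truncation t" and p: "p \<in> truncation_fixed t" and f: "0 \<le> f" "f \<le> p"
  shows "f \<in> truncation_fixed t"
proof -
  have p': "p \<ge> 0" "t p = p" using p by (auto simp: truncation_fixed_def)
  have "t f = inf (t f) p"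
    using truncation_le_and_fixed(1)[OF t f(1)] f(2) by (metis inf.absorb1 order_trans)
  also have "\<dots> = inf f p" using truncationD(2)[OF t f(1) p'(1)] p'(2) by simp
  also have "\<dots> = f" using f(2) by (rule inf.absorb1)
  finally show ?thesis using f by (simp add: truncation_fixed_def)
qed

lemma truncation_fixed_le_truncation:
  assumes t: "truncation t" and p: "p \<in> truncation_fixed t" and f: "f \<ge> 0" "p \<le> f"
  shows "p \<le> t f"
proof -
  have p': "p \<ge> 0" "t p = p" using p by (auto simp: truncation_fixed_def)
  have "p = inf (t p) f" using p' f by (simp add: inf.absorb1)
  also have "\<dots> = inf p (t f)" by (rule truncationD(2)[OF t p'(1) f(1)])
  finally show ?thesis by (metis inf.cobounded2)
qed

lemma truncation_fixed_sup:
  assumes t: "truncation t" and p: "p \<in> truncation_fixed t" "p' \<in> truncation_fixed t"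
  shows "sup p p' \<in> truncation_fixed t"
proof -
  have pos: "sup p p' \<ge> 0" using p by (auto simp: truncation_fixed_def intro: le_supI1)
  have "sup p p' \<le> t (sup p p')"
    using truncation_fixed_le_truncation[OF t p(1) pos] truncation_fixed_le_truncation[OF t p(2) pos]
    by simp
  then have "t (sup p p') = sup p p'" using truncation_le_and_fixed(1)[OF t pos] by (rule antisym[rotated])
  then show ?thesis using pos by (simp add: truncation_fixed_def)
qed

section \<open>The gauge of a strong truncation\<close>

definition gauge_bounds :: "('a::riesz_space \<Rightarrow> 'a) \<Rightarrow> 'a \<Rightarrow> real set"
  where "gauge_bounds t f = {r. r > 0 \<and> (\<exists>p\<in>truncation_fixed t. f \<le> r *\<^sub>R p)}"

definition truncation_gauge :: "('a::riesz_space \<Rightarrow> 'a) \<Rightarrow> 'a \<Rightarrow> real"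
  where "truncation_gauge t f = Inf (gauge_bounds t f)"

lemma gauge_bounds_nonempty:
  assumes "strong_truncation t"
  shows "gauge_bounds t f \<noteq> {}"
proof -
  obtain e where e: "e > 0" "e *\<^sub>R \<bar>f\<bar> \<in> truncation_fixed t"
    using assms unfolding strong_truncation_def by (meson abs_ge_zero)
  have "f \<le> inverse e *\<^sub>R (e *\<^sub>R \<bar>f\<bar>)" using e by (simp add: abs_ge_self)
  with e show ?thesis unfolding gauge_bounds_def
    by (metis (mono_tags, lifting) empty_Collect_eq positive_imp_inverse_positive)
qed

lemma gauge_bounds_bdd: "bdd_below (gauge_bounds t f)"
  by (rule bdd_belowI[of _ 0]) (simp add: gauge_bounds_def)

lemma truncation_gauge_le: "r \<in> gauge_bounds t f \<Longrightarrow> truncation_gauge t f \<le> r"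
  unfolding truncation_gauge_def by (rule cInf_lower[OF _ gauge_bounds_bdd])

lemma truncation_gauge_greatest:
  assumes "strong_truncation t" and "\<And>r. r \<in> gauge_bounds t f \<Longrightarrow> m \<le> r"
  shows "m \<le> truncation_gauge t f"
  unfolding truncation_gauge_def using gauge_bounds_nonempty[OF assms(1)] assms(2)
  by (rule cInf_greatest)

lemma gauge_bounds_up:
  assumes "r \<in> gauge_bounds t f" and "r \<le> r'"
  shows "r' \<in> gauge_bounds t f"
proof -
  obtain p where p: "r > 0" "p \<in> truncation_fixed t" "f \<le> r *\<^sub>R p"
    using assms by (auto simp: gauge_bounds_def)
  then have "r *\<^sub>R p \<le> r' *\<^sub>R p" using assms(2)
    by (intro scaleR_right_mono) (auto simp: truncation_fixed_def)
  then show ?thesis using p assms(2) by (auto simp: gauge_bounds_def intro!: bexI[of _ p])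
qed

lemma truncation_gauge_less:
  assumes "strong_truncation t" and "truncation_gauge t f < r"
  shows "r \<in> gauge_bounds t f"
proof -
  obtain r' where "r' \<in> gauge_bounds t f" "r' < r"
    using cInf_lessD[OF gauge_bounds_nonempty[OF assms(1)]] assms(2)
    unfolding truncation_gauge_def by blast
  then show ?thesis using gauge_bounds_up[of r' t f r] by simp
qed

text \<open>
  The supremum of two fixed elements serves as a common fixed element in the bounds for both vectors.
  It replaces the convex combination used for the gauge of a convex set.
\<close>

lemma sup_sublinear_truncation_gauge:
  fixes t :: "'a::riesz_space \<Rightarrow> 'a"
  assumes st: "strong_truncation t"
  shows "sup_sublinear (truncation_gauge t)"
proof (rule sup_sublinearI)
  have t: "truncation t" using st by (simp add: strong_truncation_def)
  note le = truncation_gauge_le[of _ t] and great = truncation_gauge_greatest[OF st]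
  fix f g :: 'a
  have common: "\<exists>p\<in>truncation_fixed t. f \<le> r *\<^sub>R p \<and> g \<le> s *\<^sub>R p"
    if r: "r \<in> gauge_bounds t f" and s: "s \<in> gauge_bounds t g" for r s
  proof -
    obtain p where p: "r > 0" "p \<in> truncation_fixed t" "f \<le> r *\<^sub>R p"
      using r by (auto simp: gauge_bounds_def)
    obtain p' where p': "s > 0" "p' \<in> truncation_fixed t" "g \<le> s *\<^sub>R p'"
      using s by (auto simp: gauge_bounds_def)
    have "r *\<^sub>R p \<le> r *\<^sub>R sup p p'" "s *\<^sub>R p' \<le> s *\<^sub>R sup p p'"
      using p(1) p'(1) by (auto intro!: scaleR_left_mono)
    then show ?thesis
      using p p' truncation_fixed_sup[OF t p(2) p'(2)] by (meson order_trans)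
  qed
  have "truncation_gauge t (f + g) - truncation_gauge t g \<le> r" if r: "r \<in> gauge_bounds t f" for r
  proof -
    have "truncation_gauge t (f + g) - r \<le> s" if s: "s \<in> gauge_bounds t g" for s
    proof -
      obtain p where p: "p \<in> truncation_fixed t" "f \<le> r *\<^sub>R p" "g \<le> s *\<^sub>R p"
        using common[OF r s] by blast
      then have "f + g \<le> (r + s) *\<^sub>R p" by (simp add: scaleR_add_left add_mono)
      then have "r + s \<in> gauge_bounds t (f + g)"
        using p r s by (auto simp: gauge_bounds_def)
      then show ?thesis using le by fastforce
    qed
    from great[of g, OF this] show ?thesis by simp
  qed
  from great[of f, OF this]
  show "truncation_gauge t (f + g) \<le> truncation_gauge t f + truncation_gauge t g" by simp
  have mono: "truncation_gauge t f \<le> truncation_gauge t g" if "f \<le> g" for f g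
  proof (rule great)
    fix r assume "r \<in> gauge_bounds t g"
    then have "r \<in> gauge_bounds t f" using that by (auto simp: gauge_bounds_def intro: order_trans)
    then show "truncation_gauge t f \<le> r" by (rule le)
  qed
  show "truncation_gauge t (sup f g) = max (truncation_gauge t f) (truncation_gauge t g)"
  proof (rule antisym)
    show "max (truncation_gauge t f) (truncation_gauge t g) \<le> truncation_gauge t (sup f g)"
      by (simp add: mono)
    show "truncation_gauge t (sup f g) \<le> max (truncation_gauge t f) (truncation_gauge t g)"
    proof (rule dense_ge)
      fix r assume "max (truncation_gauge t f) (truncation_gauge t g) < r"
      then have r: "r \<in> gauge_bounds t f" "r \<in> gauge_bounds t g"
        using truncation_gauge_less[OF st] by simp_all
      then obtain p where "p \<in> truncation_fixed t" "f \<le> r *\<^sub>R p" "g \<le> r *\<^sub>R p"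
        using common by blast
      then have "r \<in> gauge_bounds t (sup f g)" using r by (auto simp: gauge_bounds_def)
      then show "truncation_gauge t (sup f g) \<le> r" by (rule le)
    qed
  qed
next
  have t: "truncation t" using st by (simp add: strong_truncation_def)
  have "truncation_gauge t 0 \<le> r" if "r > 0" for r
  proof (rule truncation_gauge_le)
    have "t 0 \<in> truncation_fixed t" by (rule truncation_le_and_fixed(2)[OF t]) simp
    moreover from this have "0 \<le> r *\<^sub>R t 0" using that by (auto simp: truncation_fixed_def intro: scaleR_nonneg_nonneg)
    ultimately show "r \<in> gauge_bounds t 0" using that by (auto simp: gauge_bounds_def)
  qed
  then have "truncation_gauge t 0 \<le> 0" by (rule dense_ge)
  moreover have "0 \<le> truncation_gauge t 0"
    by (rule truncation_gauge_greatest[OF st]) (simp add: gauge_bounds_def)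
  ultimately show "truncation_gauge t 0 = 0" by simp
next
  fix c :: real and f :: 'a assume c: "c > 0"
  have "truncation_gauge t (c *\<^sub>R f) / c \<le> r" if "r \<in> gauge_bounds t f" for r
  proof -
    obtain p where p: "r > 0" "p \<in> truncation_fixed t" "f \<le> r *\<^sub>R p"
      using \<open>r \<in> gauge_bounds t f\<close> by (auto simp: gauge_bounds_def)
    have "c *\<^sub>R f \<le> (c * r) *\<^sub>R p" using scaleR_left_mono[OF p(3), of c] c by simp
    then have "c * r \<in> gauge_bounds t (c *\<^sub>R f)" using p c by (auto simp: gauge_bounds_def)
    from truncation_gauge_le[OF this] show ?thesis using c by (simp add: field_simps)
  qed
  from truncation_gauge_greatest[OF st this]
  show "truncation_gauge t (c *\<^sub>R f) \<le> c * truncation_gauge t f" using c by (simp add: field_simps)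
qed

lemma truncation_gauge_fixed_le_1:
  assumes "p \<in> truncation_fixed t"
  shows "truncation_gauge t p \<le> 1"
  by (rule truncation_gauge_le) (use assms in \<open>auto simp: gauge_bounds_def\<close>)

lemma truncation_gauge_neg_le_0:
  assumes t: "truncation t" and f: "f \<ge> 0"
  shows "truncation_gauge t (- f) \<le> 0"
proof (rule dense_ge)
  fix r :: real assume r: "r > 0"
  have "t f \<in> truncation_fixed t" by (rule truncation_le_and_fixed(2)[OF t f])
  moreover have "- f \<le> r *\<^sub>R t f"
    using f r truncationD(1)[OF t f] by (metis neg_le_0_iff_le order_trans scaleR_nonneg_nonneg less_imp_le)
  ultimately show "truncation_gauge t (- f) \<le> r"
    using r by (intro truncation_gauge_le) (auto simp: gauge_bounds_def)
qed

text \<open>If \<open>h \<le> r *\<^sub>R p\<close> with \<open>r < 1\<close> and \<open>p\<close> fixed, then \<open>h \<le> p\<close>, so \<open>h\<close> is fixed as well.\<close>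

lemma truncation_gauge_not_fixed_ge_1:
  assumes st: "strong_truncation t" and h: "h \<ge> 0" "h \<notin> truncation_fixed t"
  shows "1 \<le> truncation_gauge t h"
proof (rule ccontr)
  have t: "truncation t" using st by (simp add: strong_truncation_def)
  assume "\<not> 1 \<le> truncation_gauge t h"
  then have "1 \<in> gauge_bounds t h" by (intro truncation_gauge_less[OF st]) simp
  then obtain p where "p \<in> truncation_fixed t" "h \<le> p" by (auto simp: gauge_bounds_def)
  then show False using truncation_fixed_downward[OF t _ h(1)] h(2) by blast
qed

text \<open>
  Here \<open>g - t g\<close> stands for the positive part of \<open>g\<close> minus the unit. Given \<open>g \<le> r *\<^sub>R p\<close> with \<open>p\<close> fixed,
  \<open>inf g p\<close> is fixed and thus below \<open>t g\<close>. Adding \<open>(r - 1) *\<^sub>R p\<close> to both sides gives a bound for \<open>g\<close>.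
\<close>

lemma truncation_gauge_excess:
  assumes st: "strong_truncation t" and g: "g \<ge> 0" and ge: "1 \<le> truncation_gauge t g"
  shows "truncation_gauge t (g - t g) \<le> truncation_gauge t g - 1"
proof -
  have t: "truncation t" using st by (simp add: strong_truncation_def)
  have "truncation_gauge t (g - t g) + 1 \<le> r" if r: "truncation_gauge t g < r" for r
  proof -
    have r1: "r > 1" using r ge by simp
    obtain p where p: "p \<in> truncation_fixed t" "g \<le> r *\<^sub>R p"
      using truncation_gauge_less[OF st r] by (auto simp: gauge_bounds_def)
    have p0: "p \<ge> 0" using p by (simp add: truncation_fixed_def)
    have "inf g p \<in> truncation_fixed t"
      by (rule truncation_fixed_downward[OF t p(1)]) (use g p0 in auto)
    then have "inf g p \<le> t g" by (rule truncation_fixed_le_truncation[OF t _ g]) simp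
    then have le: "inf g p + (r - 1) *\<^sub>R p \<le> t g + (r - 1) *\<^sub>R p" by (rule add_right_mono)
    have "inf g p + (r - 1) *\<^sub>R p = inf (g + (r - 1) *\<^sub>R p) (r *\<^sub>R p)"
      using add_inf_distrib_right[of g p "(r - 1) *\<^sub>R p"] by (simp add: scaleR_diff_left)
    moreover have "g \<le> g + (r - 1) *\<^sub>R p" using r1 p0 by (simp add: scaleR_nonneg_nonneg)
    ultimately have "g \<le> inf g p + (r - 1) *\<^sub>R p" using p(2) by simp
    also note le
    finally have "g - t g \<le> (r - 1) *\<^sub>R p" by (simp add: diff_le_eq add.commute)
    then have "r - 1 \<in> gauge_bounds t (g - t g)" using p(1) r1 by (auto simp: gauge_bounds_def)
    from truncation_gauge_le[OF this] show ?thesis by simp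
  qed
  then have "truncation_gauge t (g - t g) + 1 \<le> truncation_gauge t g" by (rule dense_ge)
  then show ?thesis by simp
qed

section \<open>Points of the spectrum\<close>

lemma riesz_hom_abs: "riesz_hom (u :: 'a::riesz_space \<Rightarrow> real) \<Longrightarrow> u \<bar>f\<bar> = \<bar>u f\<bar>"
  unfolding riesz_hom_def by (simp add: abs_lattice linear_neg)

text \<open>
  A homomorphism below the gauge may be a multiple, by a factor less than \<open>1\<close>, of a point of the
  spectrum. Agreement with the gauge at a vector of gauge at least \<open>1\<close> excludes this: it
  forces \<open>u (t g) = 1\<close>, and then \<open>inf (t k) g = inf k (t g)\<close> bounds \<open>u (t k)\<close> from below.
\<close>

lemma spectrum_of_gauge_attaining:
  fixes t :: "'a::riesz_space \<Rightarrow> 'a"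
  assumes st: "strong_truncation t" and u: "riesz_hom u" and below: "u \<le> truncation_gauge t"
    and g: "g \<ge> 0" and ge: "1 \<le> truncation_gauge t g" and att: "u g = truncation_gauge t g"
  shows "u \<in> spectrum t"
proof -
  have t: "truncation t" using st by (simp add: strong_truncation_def)
  have le: "u f \<le> truncation_gauge t f" for f using below by (simp add: le_fun_def)
  have lin: "linear u" and hinf: "\<And>f k. u (inf f k) = min (u f) (u k)"
    using u by (auto simp: riesz_hom_def inf_min)
  have pos: "u f \<ge> 0" if "f \<ge> 0" for f
    using le[of "- f"] truncation_gauge_neg_le_0[OF t that] linear_neg[OF lin, of f] by simp
  have mono: "u f \<le> u k" if "f \<le> k" for f k
    using pos[of "k - f"] that linear_diff[OF lin, of k f] by simp
  have le1: "u (t k) \<le> 1" if "k \<ge> 0" for k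
    using le[of "t k"] truncation_gauge_fixed_le_1[OF truncation_le_and_fixed(2)[OF t that]] by linarith
  have "u (g - t g) \<le> u g - 1" using le[of "g - t g"] truncation_gauge_excess[OF st g ge] att by linarith
  then have tg: "u (t g) = 1" using le1[OF g] linear_diff[OF lin, of g "t g"] by simp
  have "u (t k) = min 1 (u k)" if k: "k \<ge> 0" for k
  proof (rule antisym)
    show "u (t k) \<le> min 1 (u k)"
      using le1[OF k] mono[OF truncation_le_and_fixed(1)[OF t k]] by simp
    have "min 1 (u k) = u (inf k (t g))" by (simp add: hinf tg min.commute)
    also have "\<dots> = u (inf (t k) g)" using truncationD(2)[OF t k g] by simp
    also have "\<dots> \<le> u (t k)" by (rule mono) simp
    finally show "min 1 (u k) \<le> u (t k)" .
  qed
  moreover have "u \<noteq> (\<lambda>f. 0)" using tg by auto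
  ultimately show ?thesis using u by (simp add: spectrum_def)
qed

theorem theorem3p3:
  fixes t :: "'a::riesz_space \<Rightarrow> 'a"
  assumes "strong_truncation t"
  shows "(\<Inter>u\<in>spectrum t. hom_kernel u) = infinitely_small t"
proof
  show "infinitely_small t \<subseteq> (\<Inter>u\<in>spectrum t. hom_kernel u)"
  proof (intro subsetI INT_I)
    fix f u assume f: "f \<in> infinitely_small t" and us: "u \<in> spectrum t"
    have u: "riesz_hom u" and trunc: "\<And>k. k \<ge> 0 \<Longrightarrow> u (t k) = min 1 (u k)"
      using us by (auto simp: spectrum_def)
    have bound: "e * \<bar>u f\<bar> \<le> 1" if e: "e > 0" for e
    proof -
      have k: "e *\<^sub>R \<bar>f\<bar> \<ge> 0" "t (e *\<^sub>R \<bar>f\<bar>) = e *\<^sub>R \<bar>f\<bar>"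
        using f e by (auto simp: infinitely_small_def truncation_fixed_def)
      have "u (e *\<^sub>R \<bar>f\<bar>) = e * \<bar>u f\<bar>"
        using u riesz_hom_abs[OF u] by (simp add: riesz_hom_def linear_scale)
      with trunc[OF k(1)] k(2) show ?thesis by simp
    qed
    have "u f = 0"
    proof (rule ccontr)
      assume "u f \<noteq> 0"
      with bound[of "2 / \<bar>u f\<bar>"] show False by simp
    qed
    then show "f \<in> hom_kernel u" by (simp add: hom_kernel_def)
  qed
next
  show "(\<Inter>u\<in>spectrum t. hom_kernel u) \<subseteq> infinitely_small t"
  proof (rule subsetI, rule ccontr)
    fix f assume f: "f \<in> (\<Inter>u\<in>spectrum t. hom_kernel u)" and "f \<notin> infinitely_small t"
    then obtain e where e: "e > 0" "e *\<^sub>R \<bar>f\<bar> \<notin> truncation_fixed t"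
      by (auto simp: infinitely_small_def)
    define g where "g = e *\<^sub>R \<bar>f\<bar>"
    have g: "g \<ge> 0" unfolding g_def by (rule scaleR_nonneg_nonneg) (use e in auto)
    have ge: "1 \<le> truncation_gauge t g"
      using truncation_gauge_not_fixed_ge_1[OF assms g] e by (simp add: g_def)
    obtain u where u: "riesz_hom u" "u \<le> truncation_gauge t" "u g = truncation_gauge t g"
      using riesz_hom_attaining[OF sup_sublinear_truncation_gauge[OF assms], of g] by blast
    have "u \<in> spectrum t" by (rule spectrum_of_gauge_attaining[OF assms u(1,2) g ge u(3)])
    with f have "u f = 0" by (auto simp: hom_kernel_def)
    then have "u g = 0"
      using u(1) riesz_hom_abs[OF u(1), of f] by (simp add: g_def riesz_hom_def linear_scale)
    with ge u(3) show False by simp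
  qed
qed

end
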